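(* Let $(\mathcal{X},d)$ be a complete, separable metric space with diameter $1$ and Borel probability measure $\mu$. Let $r>0$, let $n,m\in\mathbb{N}$ with $1\leq m\leq (n-3)/2$, let $\delta>0$, and let $\mathbf{X}=(X_1,\dots,X_n)\sim\mu^n$. Then each of the following two assertions holds with probability at least $1-\delta$ in $\mathbf{X}$: (a) if there exists an $r$-net $\mathbf{Y}\subset\mathbf{X}$ of cardinality $m$, then $$W_1(\mu,\hat\mu)\leq \hat M(\mathbf{X},r)+3r+2\sqrt{\frac{m}{n-m}}\left(1+\sqrt{\ln(n/\delta)}\right);$$ (b) if there exists an $r$-net $\mathbf{Y}\subset\mathbf{X}$ of cardinality $m$, then $$W_1(\mu,\hat\mu)\leq 3r+3\sqrt{\frac{m}{n-m}}\left(1+\sqrt{\ln(2n/\delta)}\right).$$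
   Context: $X_1,\dots,X_n$ are independent with law $\mu$; $\hat\mu=\frac1n\sum_{i=1}^n\delta_{X_i}$ is the empirical distribution ($\delta_x$ is the unit mass at $x$). $W_1$ is the Wasserstein-1 distance, $W_1(\mu,\nu)=\sup_f\int f\,(d\mu-d\nu)$ with the supremum over real functions $f$ on $\mathcal{X}$ with Lipschitz seminorm $1$. $\hat M(\mathbf{X},r)=\mu\{y: d(y,X_i)>r\ \forall i\in\{1,\dots,n\}\}$ is the conditional missing mass. An $r$-net of $\mathbf{X}$ of cardinality $m$ is a maximal $r$-separated sub-sample, i.e. a subsequence $\mathbf{Y}=(X_i)_{i\in I}$, $I\subseteq\{1,\dots,n\}$, $|I|=m$, such that $d(X_i,X_j)>r$ for distinct $i,j\in I$ and every $X_k$ satisfies $d(X_k,X_i)\leq r$ for some $i\in I$. *)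

theory Defs
  imports "HOL-Probability.Probability"
begin

text \<open>A sample is a function on the index set \<open>{1..n}\<close>, as in the carrier of
  the product measure \<open>Pi\<^sub>M {1..n} (\<lambda>_. \<mu>)\<close>.\<close>

text \<open>Valued in \<open>ennreal\<close>, so that functions that are not Lipschitz get \<open>\<infinity>\<close>.
  The pairs with \<open>x = y\<close> contribute \<open>0 / 0 = 0\<close>.\<close>

definition lip_seminorm :: "('a::metric_space \<Rightarrow> real) \<Rightarrow> ennreal" where
  "lip_seminorm f = (SUP x. SUP y. ennreal (\<bar>f x - f y\<bar> / dist x y))"

text \<open>Real-valued: meant for probability measures on the Borel sets of a space of finite
  diameter, where every Lipschitz function is bounded, hence integrable, and the
  supremum is over a bounded set.\<close>

definition wasserstein1 :: "'a::metric_space measure \<Rightarrow> 'a measure \<Rightarrow> real" where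
  "wasserstein1 \<mu> \<nu> =
     (SUP f \<in> {f. lip_seminorm f = 1}. integral\<^sup>L \<mu> f - integral\<^sup>L \<nu> f)"

definition empirical_measure :: "nat \<Rightarrow> (nat \<Rightarrow> 'a::topological_space) \<Rightarrow> 'a measure" where
  "empirical_measure n X =
     measure_of UNIV (sets borel)
       (\<lambda>A. (\<Sum>i=1..n. emeasure (return borel (X i)) A) / of_nat n)"

text \<open>\<open>measure_of\<close> yields the null measure unless it is given a measure;
  the following shows that this does not happen here.\<close>

lemma sets_empirical_measure: "sets (empirical_measure n X) = sets borel"
  by (simp add: empirical_measure_def sets.sigma_sets_eq[of borel, simplified])

lemma emeasure_empirical_measure:
  assumes "A \<in> sets borel"
  shows "emeasure (empirical_measure n X) A =
    (\<Sum>i=1..n. emeasure (return borel (X i)) A) / of_nat n"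
proof (rule emeasure_measure_of[OF empirical_measure_def])
  show "countably_additive (sets (empirical_measure n X))
    (\<lambda>A. (\<Sum>i=1..n. emeasure (return borel (X i)) A) / of_nat n)"
    unfolding sets_empirical_measure
  proof (rule countably_additiveI)
    fix F :: "nat \<Rightarrow> 'a set"
    assume F: "range F \<subseteq> sets borel" "disjoint_family F"
    have "(\<Sum>k. (\<Sum>i=1..n. emeasure (return borel (X i)) (F k)) / of_nat n)
        = (\<Sum>i=1..n. \<Sum>k. emeasure (return borel (X i)) (F k)) / of_nat n"
      by (simp add: divide_ennreal_def suminf_sum)
    also have "\<dots> = (\<Sum>i=1..n. emeasure (return borel (X i)) (\<Union>k. F k)) / of_nat n"
      using F by (intro arg_cong2[where f="(/)"] sum.cong refl suminf_emeasure) auto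
    finally show "(\<Sum>k. (\<Sum>i=1..n. emeasure (return borel (X i)) (F k)) / of_nat n)
        = (\<Sum>i=1..n. emeasure (return borel (X i)) (\<Union>k. F k)) / of_nat n" .
  qed
qed (use assms in \<open>auto simp: sets_empirical_measure positive_def\<close>)

definition missing_mass ::
  "'a::metric_space measure \<Rightarrow> nat \<Rightarrow> (nat \<Rightarrow> 'a) \<Rightarrow> real \<Rightarrow> real" where
  "missing_mass \<mu> n X r = measure \<mu> {y \<in> space \<mu>. \<forall>i\<in>{1..n}. dist y (X i) > r}"

text \<open>The sub-sample is represented by its set of indices \<open>I\<close>, so its cardinality
  as a subsequence is \<open>card I\<close>.\<close>

definition is_net :: "nat \<Rightarrow> (nat \<Rightarrow> 'a::metric_space) \<Rightarrow> real \<Rightarrow> nat set \<Rightarrow> bool" where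
  "is_net n X r I \<longleftrightarrow> I \<subseteq> {1..n} \<and>
     (\<forall>i\<in>I. \<forall>j\<in>I. i \<noteq> j \<longrightarrow> dist (X i) (X j) > r) \<and>
     (\<forall>k\<in>{1..n}. \<exists>i\<in>I. dist (X k) (X i) \<le> r)"

end

theory Submission
  imports Defs
begin

text \<open>Fix an index set \<open>I\<close> of size \<open>m\<close> and condition on \<open>X i\<close> for \<open>i \<in> I\<close>; the other \<open>n - m\<close> points are
  still i.i.d. Rounding a Lipschitz function to its values on the Voronoi cells of the net points
  reduces the Wasserstein distance to the largest deviation between true and empirical
  probability over the \<open>2 ^ m\<close> unions of cells. Hoeffding's inequality and a union bound over these
  sets and over the at most \<open>n ^ m\<close> choices of \<open>I\<close> control it; the points of the net itself change
  the empirical mean by at most \<open>m / n\<close>. For (b), the region not covered by the \<open>r\<close>-balls of the net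
  joins the family of sets: it contains no sample point, so its probability, and with it the
  missing mass, is bounded by the same deviation.\<close>

section \<open>Functions of Lipschitz seminorm 1 and integration against the empirical
  measure\<close>

lemma lip_seminorm_le_1D:
  assumes "lip_seminorm f \<le> 1"
  shows "\<bar>f x - f y\<bar> \<le> dist x y"
proof (cases "x = y")
  case False
  have "ennreal (\<bar>f x - f y\<bar> / dist x y) \<le> lip_seminorm f"
    unfolding lip_seminorm_def by (meson SUP_upper UNIV_I order_trans)
  then have "\<bar>f x - f y\<bar> / dist x y \<le> 1"
    using assms by (simp flip: ennreal_1) (metis ennreal_le_iff ennreal_1 order_trans zero_le_one)
  then show ?thesis
    using False by (simp add: divide_simps)
qed simp

text \<open>Ensures that the supremum in \<open>wasserstein1\<close> is over a nonempty family as
  soon as the space has two points.\<close>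

lemma lip_seminorm_dist:
  assumes "x \<noteq> y"
  shows "lip_seminorm (dist x) = 1"
  unfolding lip_seminorm_def
proof (rule antisym)
  show "(SUP a. SUP b. ennreal (\<bar>dist x a - dist x b\<bar> / dist a b)) \<le> 1"
  proof (intro SUP_least)
    fix a b
    have "\<bar>dist x a - dist x b\<bar> \<le> dist a b"
      by (metis abs_dist_diff_le dist_commute)
    then show "ennreal (\<bar>dist x a - dist x b\<bar> / dist a b) \<le> 1"
      by (simp add: divide_le_eq_1 flip: ennreal_1)
  qed
  have "1 = ennreal (\<bar>dist x x - dist x y\<bar> / dist x y)"
    using assms by simp
  also have "\<dots> \<le> (SUP a. SUP b. ennreal (\<bar>dist x a - dist x b\<bar> / dist a b))"
    by (meson SUP_upper UNIV_I order_trans)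
  finally show "1 \<le> (SUP a. SUP b. ennreal (\<bar>dist x a - dist x b\<bar> / dist a b))" .
qed

lemma continuous_on_1_lipschitz:
  fixes f :: "'a::metric_space \<Rightarrow> real"
  assumes "\<And>x y. \<bar>f x - f y\<bar> \<le> dist x y"
  shows "continuous_on UNIV f"
proof -
  have "1-lipschitz_on UNIV f"
    using assms by (auto simp: lipschitz_on_def dist_real_def)
  then show ?thesis
    by (rule lipschitz_on_continuous_on)
qed

text \<open>As the law of \<open>X\<close> at a uniformly random index, the empirical measure
  inherits its integration theory from image measures and finite pmfs.\<close>

lemma empirical_measure_eq_distr:
  assumes "n \<ge> 1"
  shows "empirical_measure n X = distr (measure_pmf (pmf_of_set {1..n})) borel X"
proof (rule measure_eqI)
  fix A assume "A \<in> sets (empirical_measure n X)"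
  then have A: "A \<in> sets borel"
    by (simp add: sets_empirical_measure)
  have "(\<Sum>i=1..n. emeasure (return borel (X i)) A) = of_nat (card ({1..n} \<inter> X -` A))"
    using A by (simp add: indicator_def sum.If_cases vimage_def Int_def)
  then show "emeasure (empirical_measure n X) A
      = emeasure (distr (measure_pmf (pmf_of_set {1..n})) borel X) A"
    using A assms
    by (simp add: emeasure_empirical_measure emeasure_distr emeasure_pmf_of_set
        divide_ennreal ennreal_of_nat_eq_real_of_nat)
qed (simp add: sets_empirical_measure)

lemma integral_empirical_measure:
  fixes f :: "'a::topological_space \<Rightarrow> real"
  assumes "n \<ge> 1" and "f \<in> borel_measurable borel"
  shows "integral\<^sup>L (empirical_measure n X) f = (\<Sum>i=1..n. f (X i)) / real n"
  using assms by (simp add: empirical_measure_eq_distr integral_distr integral_pmf_of_set)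

section \<open>One-sided Hoeffding bounds for frequencies\<close>

text \<open>The indicators of \<open>Z i \<in> A\<close> are i.i.d. under the product measure, take
  values in [0, 1] and have mean \<open>measure M A\<close>, so Hoeffding's inequality applies with
  range 1. The lower tail suffices: only an excess of the true probability over the frequency has to
  be excluded.\<close>

lemma hoeffding_frequency:
  assumes "prob_space M" and A: "A \<in> sets M" and J: "finite J" "J \<noteq> {}" and "t \<ge> 0"
  shows "measure (Pi\<^sub>M J (\<lambda>_. M))
      {Z \<in> space (Pi\<^sub>M J (\<lambda>_. M)).
        (\<Sum>i\<in>J. indicator A (Z i)) / real (card J) \<le> measure M A - t}
    \<le> exp (- 2 * real (card J) * t\<^sup>2)"
proof -
  interpret M: prob_space M by fact
  interpret P: prob_space "Pi\<^sub>M J (\<lambda>_. M)"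
    by (intro prob_space_PiM assms)
  note [measurable] = A
  obtain j where j: "j \<in> J"
    using J by auto
  define X :: "'b \<Rightarrow> ('b \<Rightarrow> 'a) \<Rightarrow> real" where "X i Z = indicator A (Z i)" for i Z
  have X [measurable]: "X i \<in> borel_measurable (Pi\<^sub>M J (\<lambda>_. M))" if "i \<in> J" for i
    using that unfolding X_def by measurable
  have comp: "distr (Pi\<^sub>M J (\<lambda>_. M)) M (\<lambda>Z. Z i) = M" if "i \<in> J" for i
    using that assms by (intro distr_PiM_component)
  have dX: "distr (Pi\<^sub>M J (\<lambda>_. M)) borel (X i) = distr M borel (indicator A :: 'a \<Rightarrow> real)"
    if "i \<in> J" for i
  proof -
    have "distr M borel (indicator A :: 'a \<Rightarrow> real)
        = distr (distr (Pi\<^sub>M J (\<lambda>_. M)) M (\<lambda>Z. Z i)) borel (indicator A)"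
      using comp[OF that] by simp
    also have "\<dots> = distr (Pi\<^sub>M J (\<lambda>_. M)) borel (X i)"
      using that by (subst distr_distr) (auto simp: X_def[abs_def] o_def)
    finally show ?thesis ..
  qed
  \<comment> \<open>Independence amounts to the joint law being the product of the marginal laws.
    Restricting to \<open>J\<close> changes nothing because points of the product space are
    extensional.\<close>
  have indep_coord: "P.indep_vars (\<lambda>_. M) (\<lambda>i Z. Z i) J"
  proof (subst P.indep_vars_iff_distr_eq_PiM'[OF J(2)])
    have "distr (Pi\<^sub>M J (\<lambda>_. M)) (Pi\<^sub>M J (\<lambda>_. M)) (\<lambda>Z. \<lambda>i\<in>J. Z i)
        = distr (Pi\<^sub>M J (\<lambda>_. M)) (Pi\<^sub>M J (\<lambda>_. M)) (\<lambda>Z. Z)"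
      by (intro distr_cong) (auto simp: space_PiM PiE_def extensional_restrict)
    also have "\<dots> = (\<Pi>\<^sub>M i\<in>J. distr (Pi\<^sub>M J (\<lambda>_. M)) M (\<lambda>Z. Z i))"
      unfolding distr_id by (intro PiM_cong) (simp_all add: comp)
    finally show "distr (Pi\<^sub>M J (\<lambda>_. M)) (Pi\<^sub>M J (\<lambda>_. M)) (\<lambda>Z. \<lambda>i\<in>J. Z i)
        = (\<Pi>\<^sub>M i\<in>J. distr (Pi\<^sub>M J (\<lambda>_. M)) M (\<lambda>Z. Z i))" .
  qed auto
  have indep: "P.indep_vars (\<lambda>_. borel) X J"
    unfolding X_def by (rule P.indep_vars_compose2[OF indep_coord]) auto
  have EX: "P.expectation (X j) = measure M A"
  proof -
    have "P.expectation (X j) = integral\<^sup>L (distr (Pi\<^sub>M J (\<lambda>_. M)) borel (X j)) (\<lambda>x. x)"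
      using j by (subst integral_distr) auto
    also have "\<dots> = measure M A"
      unfolding dX[OF j] by (subst integral_distr) auto
    finally show ?thesis .
  qed
  interpret H: Hoeffding_ineq_iid "Pi\<^sub>M J (\<lambda>_. M)" J X "X j" 0 1 "measure M A"
  proof unfold_locales
    show "distr (Pi\<^sub>M J (\<lambda>_. M)) borel (X i) = distr (Pi\<^sub>M J (\<lambda>_. M)) borel (X j)"
      if "i \<in> J" for i
      using dX that j by simp
    show "measure M A \<equiv> P.expectation (X j)"
      using EX by simp
  qed (use J j indep in \<open>auto simp: X_def indicator_def\<close>)
  show ?thesis
    using H.Hoeffding_ineq_le'[OF \<open>t \<ge> 0\<close> _ J(2)] by (simp add: X_def)
qed

text \<open>Hoeffding's inequality for a set that depends on the coordinates in \<open>I\<close>, tested on the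
  remaining coordinates: conditionally on the former, the set is fixed.\<close>

lemma hoeffding_frequency_dependent:
  fixes M :: "'a measure" and A :: "('i \<Rightarrow> 'a) \<Rightarrow> 'a set"
  assumes "prob_space M" and K: "finite K" "I \<subseteq> K" "I \<noteq> K" and t: "t \<ge> 0"
    and A: "{p \<in> space (Pi\<^sub>M I (\<lambda>_. M) \<Otimes>\<^sub>M M). snd p \<in> A (fst p)}
              \<in> sets (Pi\<^sub>M I (\<lambda>_. M) \<Otimes>\<^sub>M M)"
    and AM: "\<And>Y. A Y \<subseteq> space M"
  defines "B \<equiv> {X \<in> space (Pi\<^sub>M K (\<lambda>_. M)).
      (\<Sum>i\<in>K - I. indicator (A (restrict X I)) (X i)) / real (card (K - I))
        \<le> measure M (A (restrict X I)) - t}"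
  shows "B \<in> sets (Pi\<^sub>M K (\<lambda>_. M))"
    and "measure (Pi\<^sub>M K (\<lambda>_. M)) B \<le> exp (- 2 * real (card (K - I)) * t\<^sup>2)"
proof -
  interpret M: prob_space M by fact
  interpret prod: product_sigma_finite "\<lambda>_::'i. M"
    by unfold_locales
  interpret PI: prob_space "Pi\<^sub>M I (\<lambda>_. M)"
    by (intro prob_space_PiM assms)
  interpret PK: prob_space "Pi\<^sub>M K (\<lambda>_. M)"
    by (intro prob_space_PiM assms)
  interpret PJ: prob_space "Pi\<^sub>M (K - I) (\<lambda>_. M)"
    by (intro prob_space_PiM assms)
  let ?Q = "{p \<in> space (Pi\<^sub>M I (\<lambda>_. M) \<Otimes>\<^sub>M M). snd p \<in> A (fst p)}"
  have [measurable]: "Measurable.pred (Pi\<^sub>M I (\<lambda>_. M) \<Otimes>\<^sub>M M) (\<lambda>p. snd p \<in> A (fst p))"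
    using A by (simp add: pred_def)
  have slice: "Pair Y -` ?Q = A Y" if "Y \<in> space (Pi\<^sub>M I (\<lambda>_. M))" for Y
    using that AM[of Y] by (auto simp: space_pair_measure)
  have AY: "A Y \<in> sets M" if "Y \<in> space (Pi\<^sub>M I (\<lambda>_. M))" for Y
    using sets_Pair1[OF A, of Y] slice[OF that] by simp
  have "(\<lambda>Y. measure M (Pair Y -` ?Q)) \<in> borel_measurable (Pi\<^sub>M I (\<lambda>_. M))"
    unfolding measure_def using M.measurable_emeasure_Pair[OF A] by measurable
  then have mA [measurable]: "(\<lambda>Y. measure M (A Y)) \<in> borel_measurable (Pi\<^sub>M I (\<lambda>_. M))"
    by (rule measurable_cong[THEN iffD1, rotated]) (simp only: slice)
  have [measurable]: "(\<lambda>X. restrict X I) \<in> measurable (Pi\<^sub>M K (\<lambda>_. M)) (Pi\<^sub>M I (\<lambda>_. M))"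
    using K by (intro measurable_restrict_subset)
  have ind [measurable]:
    "(\<lambda>X. indicator (A (restrict X I)) (X i) :: real) \<in> borel_measurable (Pi\<^sub>M K (\<lambda>_. M))"
    if "i \<in> K - I" for i
  proof -
    have [measurable]: "(\<lambda>X. X i) \<in> measurable (Pi\<^sub>M K (\<lambda>_. M)) M"
      using that by simp
    have "(\<lambda>X. (restrict X I, X i)) \<in> measurable (Pi\<^sub>M K (\<lambda>_. M)) (Pi\<^sub>M I (\<lambda>_. M) \<Otimes>\<^sub>M M)"
      by measurable
    then have "Measurable.pred (Pi\<^sub>M K (\<lambda>_. M)) (\<lambda>X. X i \<in> A (restrict X I))"
      using measurable_compose[of "\<lambda>X. (restrict X I, X i)" _ _ "\<lambda>p. snd p \<in> A (fst p)"] by simp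
    then have "(\<lambda>X. of_bool (X i \<in> A (restrict X I)) :: real)
        \<in> borel_measurable (Pi\<^sub>M K (\<lambda>_. M))"
      by measurable
    then show ?thesis
      by (simp add: indicator_def of_bool_def cong: if_cong)
  qed
  show B: "B \<in> sets (Pi\<^sub>M K (\<lambda>_. M))"
    unfolding B_def by measurable
  have KI: "I \<union> (K - I) = K" "finite I" "K - I \<noteq> {}"
    using K by (auto intro: finite_subset)
  have "emeasure (Pi\<^sub>M K (\<lambda>_. M)) B = (\<integral>\<^sup>+X. indicator B X \<partial>Pi\<^sub>M K (\<lambda>_. M))"
    using B by simp
  \<comment> \<open>Tonelli's theorem: the coordinates outside \<open>I\<close> are integrated
    first, with those in \<open>I\<close> frozen at \<open>Y\<close>.\<close>
  also have "\<dots> = (\<integral>\<^sup>+Y. \<integral>\<^sup>+Z. indicator B (merge I (K - I) (Y, Z))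
      \<partial>Pi\<^sub>M (K - I) (\<lambda>_. M) \<partial>Pi\<^sub>M I (\<lambda>_. M))"
    using prod.product_nn_integral_fold[of I "K - I" "indicator B"] K KI B by simp
  also have "\<dots> \<le> (\<integral>\<^sup>+Y. ennreal (exp (- 2 * real (card (K - I)) * t\<^sup>2)) \<partial>Pi\<^sub>M I (\<lambda>_. M))"
  proof (rule nn_integral_mono)
    fix Y assume Y: "Y \<in> space (Pi\<^sub>M I (\<lambda>_. M))"
    let ?C = "{Z \<in> space (Pi\<^sub>M (K - I) (\<lambda>_. M)).
        (\<Sum>i\<in>K - I. indicator (A Y) (Z i)) / real (card (K - I)) \<le> measure M (A Y) - t}"
    note [measurable] = AY[OF Y]
    have C: "?C \<in> sets (Pi\<^sub>M (K - I) (\<lambda>_. M))"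
      by measurable
    \<comment> \<open>For frozen \<open>Y\<close>, the section of \<open>B\<close> is the plain
      Hoeffding event for the fixed set \<open>A Y\<close>.\<close>
    have "(\<integral>\<^sup>+Z. indicator B (merge I (K - I) (Y, Z)) \<partial>Pi\<^sub>M (K - I) (\<lambda>_. M))
        = (\<integral>\<^sup>+Z. indicator ?C Z \<partial>Pi\<^sub>M (K - I) (\<lambda>_. M))"
    proof (rule nn_integral_cong)
      fix Z assume Z: "Z \<in> space (Pi\<^sub>M (K - I) (\<lambda>_. M))"
      have "restrict (merge I (K - I) (Y, Z)) I = Y"
        using Y by (auto simp: space_PiM PiE_def extensional_restrict)
      moreover have "merge I (K - I) (Y, Z) \<in> space (Pi\<^sub>M K (\<lambda>_. M))"
        using Y Z KI(1) K(2) by (auto simp: space_PiM PiE_iff merge_def extensional_def)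
      moreover have "(\<Sum>i\<in>K - I. indicator (A Y) (merge I (K - I) (Y, Z) i))
          = (\<Sum>i\<in>K - I. indicator (A Y) (Z i) :: real)"
        by (intro sum.cong) (auto simp: merge_def)
      ultimately have "merge I (K - I) (Y, Z) \<in> B \<longleftrightarrow> Z \<in> ?C"
        using Z by (simp add: B_def)
      then show "(indicator B (merge I (K - I) (Y, Z)) :: ennreal) = indicator ?C Z"
        by (simp add: indicator_def)
    qed
    also have "\<dots> = ennreal (measure (Pi\<^sub>M (K - I) (\<lambda>_. M)) ?C)"
      using C by (simp add: PJ.emeasure_eq_measure)
    also have "\<dots> \<le> ennreal (exp (- 2 * real (card (K - I)) * t\<^sup>2))"
      using hoeffding_frequency[OF assms(1) AY[OF Y], of "K - I" t] K KI t
      by (intro ennreal_leI) simp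
    finally show "(\<integral>\<^sup>+Z. indicator B (merge I (K - I) (Y, Z)) \<partial>Pi\<^sub>M (K - I) (\<lambda>_. M))
        \<le> ennreal (exp (- 2 * real (card (K - I)) * t\<^sup>2))" .
  qed
  also have "\<dots> = ennreal (exp (- 2 * real (card (K - I)) * t\<^sup>2))"
    by (simp add: PI.emeasure_space_1)
  finally show "measure (Pi\<^sub>M K (\<lambda>_. M)) B \<le> exp (- 2 * real (card (K - I)) * t\<^sup>2)"
    by (simp add: PK.emeasure_eq_measure)
qed

section \<open>Voronoi cells and test sets\<close>

text \<open>Taking the smallest index among the closest points breaks ties, so that the cells
  partition the space.\<close>

definition nearest :: "nat set \<Rightarrow> (nat \<Rightarrow> 'a::metric_space) \<Rightarrow> 'a \<Rightarrow> nat" where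
  "nearest I X y = (LEAST j. j \<in> I \<and> (\<forall>k\<in>I. dist y (X j) \<le> dist y (X k)))"

lemma
  assumes "finite I" "I \<noteq> {}"
  shows nearest_in: "nearest I X y \<in> I"
    and nearest_le: "k \<in> I \<Longrightarrow> dist y (X (nearest I X y)) \<le> dist y (X k)"
proof -
  obtain j where "j \<in> I" "\<forall>k\<in>I. dist y (X j) \<le> dist y (X k)"
    using ex_min_if_finite[of "(\<lambda>k. dist y (X k)) ` I"] assms by (force simp: not_less)
  then have "nearest I X y \<in> I \<and> (\<forall>k\<in>I. dist y (X (nearest I X y)) \<le> dist y (X k))"
    unfolding nearest_def by (intro LeastI) auto
  then show "nearest I X y \<in> I"
    and "k \<in> I \<Longrightarrow> dist y (X (nearest I X y)) \<le> dist y (X k)"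
    by auto
qed

lemma nearest_restrict: "nearest I (restrict X I) = nearest I X"
  by (simp add: nearest_def fun_eq_iff cong: conj_cong)

text \<open>The cells move with the net, so conditioning on the net calls for measurability jointly
  in the centres and the point. It holds because the least index satisfying measurable predicates is
  measurable.\<close>

lemma measurable_nearest:
  fixes M :: "'a::{metric_space, second_countable_topology} measure"
  assumes [measurable_cong]: "sets M = sets borel"
  shows "(\<lambda>p. nearest I (fst p) (snd p))
    \<in> measurable (Pi\<^sub>M I (\<lambda>_. M) \<Otimes>\<^sub>M M) (count_space UNIV)"
proof -
  have [measurable]: "(\<lambda>p. dist (snd p) (fst p k))
      \<in> borel_measurable (Pi\<^sub>M I (\<lambda>_. M) \<Otimes>\<^sub>M M)" if "k \<in> I" for k
  proof -
    have [measurable]: "(\<lambda>p. fst p k) \<in> measurable (Pi\<^sub>M I (\<lambda>_. M) \<Otimes>\<^sub>M M) borel"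
      using that by measurable
    show ?thesis
      by measurable
  qed
  have "Measurable.pred (Pi\<^sub>M I (\<lambda>_. M) \<Otimes>\<^sub>M M)
      (\<lambda>p. j \<in> I \<and> (\<forall>k\<in>I. dist (snd p) (fst p j) \<le> dist (snd p) (fst p k)))" for j
  proof (cases "j \<in> I")
    case True
    then have "Measurable.pred (Pi\<^sub>M I (\<lambda>_. M) \<Otimes>\<^sub>M M)
        (\<lambda>p. \<forall>k\<in>I. dist (snd p) (fst p j) \<le> dist (snd p) (fst p k))"
      by (intro pred_intros_countable_bounded(3)) measurable
    with True show ?thesis
      by simp
  qed simp
  then show ?thesis
    unfolding nearest_def by (rule measurable_Least)
qed

text \<open>The sets on which the empirical and the true probability are compared: unions of
  Voronoi cells of the net, and the region that its \<open>r\<close>-balls do not cover.\<close>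

definition test_sets :: "nat set \<Rightarrow> real \<Rightarrow> ((nat \<Rightarrow> 'a::metric_space) \<Rightarrow> 'a set) set" where
  "test_sets I r = insert (\<lambda>X. {y. \<forall>j\<in>I. dist y (X j) > r})
     ((\<lambda>S X. {y. nearest I X y \<in> S}) ` Pow I)"

lemma
  assumes "finite I"
  shows finite_test_sets: "finite (test_sets I r :: ((nat \<Rightarrow> 'a::metric_space) \<Rightarrow> 'a set) set)"
    and card_test_sets:
      "card (test_sets I r :: ((nat \<Rightarrow> 'a) \<Rightarrow> 'a set) set) \<le> 2 ^ card I + 1"
proof -
  let ?T = "test_sets I r :: ((nat \<Rightarrow> 'a) \<Rightarrow> 'a set) set"
  let ?F = "(\<lambda>S (X :: nat \<Rightarrow> 'a). {y. nearest I X y \<in> S}) ` Pow I"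
  show "finite ?T"
    using assms by (simp add: test_sets_def)
  have "card ?T \<le> Suc (card ?F)"
    unfolding test_sets_def using assms by (simp add: card_insert_if)
  also have "card ?F \<le> 2 ^ card I"
    using card_image_le[of "Pow I"] assms by (simp add: card_Pow)
  finally show "card ?T \<le> 2 ^ card I + 1"
    by simp
qed

text \<open>Once the coordinates in \<open>I\<close> are fixed, a test set is a fixed set, and the
  remaining points are independent samples to test it on.\<close>

lemma test_sets_restrict:
  assumes "A \<in> test_sets I r"
  shows "A (restrict X I) = A X"
  using assms by (auto simp: test_sets_def nearest_restrict)

lemma measurable_test_sets:
  fixes M :: "'a::{metric_space, second_countable_topology} measure"
  assumes [measurable_cong]: "sets M = sets borel" and "A \<in> test_sets I r"
  shows "{p \<in> space (Pi\<^sub>M I (\<lambda>_. M) \<Otimes>\<^sub>M M). snd p \<in> A (fst p)}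
    \<in> sets (Pi\<^sub>M I (\<lambda>_. M) \<Otimes>\<^sub>M M)"
proof -
  have [measurable]: "(\<lambda>p. dist (snd p) (fst p k))
      \<in> borel_measurable (Pi\<^sub>M I (\<lambda>_. M) \<Otimes>\<^sub>M M)" if "k \<in> I" for k
  proof -
    have [measurable]: "(\<lambda>p. fst p k) \<in> measurable (Pi\<^sub>M I (\<lambda>_. M) \<Otimes>\<^sub>M M) borel"
      using that by measurable
    show ?thesis
      by measurable
  qed
  note [measurable] = measurable_nearest[OF assms(1), of I]
  from assms(2) consider "A = (\<lambda>X. {y. \<forall>j\<in>I. dist y (X j) > r})"
    | S where "A = (\<lambda>X. {y. nearest I X y \<in> S})"
    by (auto simp: test_sets_def)
  then have "Measurable.pred (Pi\<^sub>M I (\<lambda>_. M) \<Otimes>\<^sub>M M) (\<lambda>p. snd p \<in> A (fst p))"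
  proof cases
    case 1
    have "Measurable.pred (Pi\<^sub>M I (\<lambda>_. M) \<Otimes>\<^sub>M M)
        (\<lambda>p. \<forall>j\<in>I. r < dist (snd p) (fst p j))"
      by (intro pred_intros_countable_bounded(3)) measurable
    with 1 show ?thesis
      by simp
  next
    case 2
    then show ?thesis
      by simp
  qed
  then show ?thesis
    by (simp add: pred_def)
qed

section \<open>A deviation bound uniform over nets and test sets\<close>

text \<open>The net is selected after the sample is seen, so one event has to serve all index sets
  of size \<open>m\<close>. The threshold \<open>t\<close> makes Hoeffding's bound exp (- 2 (n - m)
  t^2) equal to (\<delta> / (4 n))^m, small enough for at most n^m index sets with at most 2^(m + 1)
  test sets each.\<close>

lemma uniform_deviation_test_sets:
  fixes M :: "'a::{metric_space, second_countable_topology} measure" and n m :: nat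
  assumes "prob_space M" and M: "sets M = sets borel"
    and m: "1 \<le> m" "m < n" and \<delta>: "0 < \<delta>" "\<delta> \<le> 1"
  defines "t \<equiv> sqrt (real m * ln (4 * real n / \<delta>) / (2 * (real n - real m)))"
  obtains G where "G \<in> sets (Pi\<^sub>M {1..n} (\<lambda>_. M))"
    and "measure (Pi\<^sub>M {1..n} (\<lambda>_. M)) G \<ge> 1 - \<delta>"
    and "\<And>X I A. X \<in> G \<Longrightarrow> I \<subseteq> {1..n} \<Longrightarrow> card I = m \<Longrightarrow> A \<in> test_sets I r \<Longrightarrow>
      measure M (A X) \<le> t + (\<Sum>i\<in>{1..n} - I. indicator (A X) (X i)) / (real n - real m)"
proof -
  interpret P: prob_space "Pi\<^sub>M {1..n} (\<lambda>_. M)"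
    by (intro prob_space_PiM assms)
  let ?K = "{1..n}" and ?L = "ln (4 * real n / \<delta>)"
  define B where "B I A = {X \<in> space (Pi\<^sub>M ?K (\<lambda>_. M)).
      (\<Sum>i\<in>?K - I. indicator (A (restrict X I)) (X i)) / real (card (?K - I))
        \<le> measure M (A (restrict X I)) - t}" for I and A :: "(nat \<Rightarrow> 'a) \<Rightarrow> 'a set"
  define \<I> where "\<I> = {I. I \<subseteq> ?K \<and> card I = m}"
  have "1 \<le> 4 * real n / \<delta>"
    using m \<delta> by (simp add: divide_simps)
  then have L: "?L \<ge> 0"
    by simp
  have t: "t \<ge> 0" and t2: "2 * (real n - real m) * t\<^sup>2 = real m * ?L"
    using L m by (auto simp: t_def)
  have space: "space M = UNIV"
    using M by (metis sets_eq_imp_space_eq space_borel)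
  have fin: "finite \<I>" and cardI: "card \<I> = n choose m"
    using n_subsets[of ?K m] unfolding \<I>_def by auto
  define \<epsilon> where "\<epsilon> = (\<delta> / (4 * real n)) ^ m"
  have B: "B I A \<in> sets (Pi\<^sub>M ?K (\<lambda>_. M))" "measure (Pi\<^sub>M ?K (\<lambda>_. M)) (B I A) \<le> \<epsilon>"
    if I: "I \<in> \<I>" and A: "A \<in> test_sets I r" for I and A :: "(nat \<Rightarrow> 'a) \<Rightarrow> 'a set"
  proof -
    from I m have IK: "I \<subseteq> ?K" "I \<noteq> ?K" "card (?K - I) = n - m"
      by (auto simp: \<I>_def card_Diff_subset finite_subset)
    note h = hoeffding_frequency_dependent[OF assms(1) _ IK(1,2) t measurable_test_sets[OF M A]]
    show "B I A \<in> sets (Pi\<^sub>M ?K (\<lambda>_. M))"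
      unfolding B_def by (intro h) (simp_all add: space)
    have "measure (Pi\<^sub>M ?K (\<lambda>_. M)) (B I A) \<le> exp (- 2 * real (card (?K - I)) * t\<^sup>2)"
      unfolding B_def by (intro h) (simp_all add: space)
    also have "\<dots> = exp (- (real m * ?L))"
      using t2 IK m by (simp add: of_nat_diff algebra_simps)
    also have "\<dots> = \<epsilon>"
    proof -
      have "exp (- ?L) = \<delta> / (4 * real n)"
        using m \<delta> by (simp add: exp_minus field_simps)
      then show ?thesis
        unfolding \<epsilon>_def by (metis exp_of_nat_mult mult_minus_right)
    qed
    finally show "measure (Pi\<^sub>M ?K (\<lambda>_. M)) (B I A) \<le> \<epsilon>" .
  qed
  define U where "U = (\<Union>I\<in>\<I>. \<Union>A\<in>test_sets I r. B I A)"
  have finI: "finite I" if "I \<in> \<I>" for I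
    using that finite_subset by (auto simp: \<I>_def)
  have U1: "(\<Union>A\<in>test_sets I r. B I A) \<in> sets (Pi\<^sub>M ?K (\<lambda>_. M))" if "I \<in> \<I>" for I
    using that finI by (intro sets.finite_UN finite_test_sets B) auto
  have U: "U \<in> sets (Pi\<^sub>M ?K (\<lambda>_. M))"
    unfolding U_def by (intro sets.finite_UN fin U1)
  have "measure (Pi\<^sub>M ?K (\<lambda>_. M)) U
      \<le> (\<Sum>I\<in>\<I>. measure (Pi\<^sub>M ?K (\<lambda>_. M)) (\<Union>A\<in>test_sets I r. B I A))"
    unfolding U_def by (intro measure_UNION_le fin U1)
  also have "\<dots> \<le> (\<Sum>I\<in>\<I>. 2 ^ (m + 1) * \<epsilon>)"
  proof (rule sum_mono)
    fix I assume I: "I \<in> \<I>"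
    have "measure (Pi\<^sub>M ?K (\<lambda>_. M)) (\<Union>A\<in>test_sets I r. B I A)
        \<le> (\<Sum>A\<in>test_sets I r. measure (Pi\<^sub>M ?K (\<lambda>_. M)) (B I A))"
      using I finI by (intro measure_UNION_le finite_test_sets B) auto
    also have "\<dots> \<le> real (card (test_sets I r :: ((nat \<Rightarrow> 'a) \<Rightarrow> 'a set) set)) * \<epsilon>"
      using I B by (intro sum_bounded_above) auto
    also have "\<dots> \<le> 2 ^ (m + 1) * \<epsilon>"
    proof (intro mult_right_mono)
      have "card (test_sets I r :: ((nat \<Rightarrow> 'a) \<Rightarrow> 'a set) set) \<le> 2 ^ m + 1"
        using card_test_sets[OF finI[OF I], of r] I by (simp add: \<I>_def)
      also have "\<dots> \<le> 2 ^ (m + 1)"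
        by simp
      finally show "real (card (test_sets I r :: ((nat \<Rightarrow> 'a) \<Rightarrow> 'a set) set)) \<le> 2 ^ (m + 1)"
        by (metis of_nat_le_iff of_nat_numeral of_nat_power)
    qed (use \<delta> in \<open>simp add: \<epsilon>_def\<close>)
    finally show "measure (Pi\<^sub>M ?K (\<lambda>_. M)) (\<Union>A\<in>test_sets I r. B I A) \<le> 2 ^ (m + 1) * \<epsilon>" .
  qed
  also have "\<dots> = real (n choose m) * (2 ^ (m + 1) * \<epsilon>)"
    by (simp add: cardI)
  also have "\<dots> \<le> real n ^ m * (2 ^ (m + 1) * \<epsilon>)"
    using binomial_le_pow[of m n] m \<delta>
    by (intro mult_right_mono) (simp_all add: \<epsilon>_def flip: of_nat_power)
  also have "\<dots> = 2 * (real n * 2 * (\<delta> / (4 * real n))) ^ m"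
    by (simp only: \<epsilon>_def power_mult_distrib power_add power_one_right mult_ac)
  also have "\<dots> = 2 * (\<delta> / 2) ^ m"
    using m by simp
  \<comment> \<open>The 4 in \<open>t\<close> covers a factor 2 per net point from the unions of
    cells and leaves the base \<delta> / 2. Exponent 1 is the worst case, where this half cancels
    the factor 2 in front.\<close>
  also have "\<dots> \<le> 2 * (\<delta> / 2) ^ 1"
    using m \<delta> by (intro mult_left_mono power_decreasing) auto
  also have "\<dots> = \<delta>"
    by simp
  finally have \<delta>U: "measure (Pi\<^sub>M ?K (\<lambda>_. M)) U \<le> \<delta>" .
  show thesis
  proof (rule that[of "space (Pi\<^sub>M ?K (\<lambda>_. M)) - U"])
    show "1 - \<delta> \<le> measure (Pi\<^sub>M ?K (\<lambda>_. M)) (space (Pi\<^sub>M ?K (\<lambda>_. M)) - U)"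
      using P.prob_compl[OF U] \<delta>U by simp
    fix X I and A :: "(nat \<Rightarrow> 'a) \<Rightarrow> 'a set" assume X: "X \<in> space (Pi\<^sub>M ?K (\<lambda>_. M)) - U"
      and I: "I \<subseteq> {1..n}" "card I = m" and A: "A \<in> test_sets I r"
    have "X \<notin> B I A"
      using X I A by (auto simp: U_def \<I>_def)
    moreover have "real (card (?K - I)) = real n - real m"
      using I m by (simp add: card_Diff_subset finite_subset of_nat_diff)
    ultimately show "measure M (A X)
        \<le> t + (\<Sum>i\<in>{1..n} - I. indicator (A X) (X i)) / (real n - real m)"
      using X test_sets_restrict[OF A] by (auto simp: B_def)
  qed (use U in auto)
qed

section \<open>Deterministic bounds from small deviations on the test sets\<close>

text \<open>The rounded function is simple: it is constant on each of finitely many cells.\<close>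

lemma integral_nearest:
  fixes g :: "nat \<Rightarrow> real"
  assumes "prob_space M" and I: "finite I" "I \<noteq> {}"
    and meas: "nearest I X \<in> measurable M (count_space UNIV)"
  shows "(\<integral>y. g (nearest I X y) \<partial>M)
    = (\<Sum>j\<in>I. g j * measure M (nearest I X -` {j} \<inter> space M))"
    and "integrable M (\<lambda>y. g (nearest I X y))"
proof -
  interpret prob_space M by fact
  note [measurable] = meas
  have eq: "g (nearest I X y) = (\<Sum>j\<in>I. g j * indicator (nearest I X -` {j} \<inter> space M) y)"
    if "y \<in> space M" for y
    using I nearest_in[OF I, of X y] that by (simp add: indicator_def if_distrib cong: if_cong)
  have sets: "nearest I X -` {j} \<inter> space M \<in> sets M" for j
    by measurable
  have int: "integrable M (indicator (nearest I X -` {j} \<inter> space M) :: 'a \<Rightarrow> real)" for j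
    using sets by (intro integrable_real_indicator) (auto simp: emeasure_eq_measure)
  have "integrable M (\<lambda>y. \<Sum>j\<in>I. g j * indicator (nearest I X -` {j} \<inter> space M) y)"
    by (intro Bochner_Integration.integrable_sum integrable_mult_right int)
  then show "integrable M (\<lambda>y. g (nearest I X y))"
    by (rule Bochner_Integration.integrable_cong[THEN iffD1, rotated -1]) (simp_all add: eq)
  have "(\<integral>y. g (nearest I X y) \<partial>M)
      = (\<integral>y. (\<Sum>j\<in>I. g j * indicator (nearest I X -` {j} \<inter> space M) y) \<partial>M)"
    by (intro Bochner_Integration.integral_cong) (simp_all add: eq)
  also have "\<dots> = (\<Sum>j\<in>I. g j * measure M (nearest I X -` {j} \<inter> space M))"
    using int sets by (subst Bochner_Integration.integral_sum) simp_all
  finally show "(\<integral>y. g (nearest I X y) \<partial>M)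
      = (\<Sum>j\<in>I. g j * measure M (nearest I X -` {j} \<inter> space M))" .
qed

lemma measurable_nearest_section:
  fixes M :: "'a::{metric_space, second_countable_topology} measure"
  assumes [measurable_cong]: "sets M = sets borel"
  shows "nearest I X \<in> measurable M (count_space UNIV)"
proof -
  have "restrict X I \<in> space (Pi\<^sub>M I (\<lambda>_. M))"
    using sets_eq_imp_space_eq[OF assms] by (simp add: space_PiM)
  then have "(\<lambda>y. (restrict X I, y)) \<in> measurable M (Pi\<^sub>M I (\<lambda>_. M) \<Otimes>\<^sub>M M)"
    by simp
  from measurable_compose[OF this measurable_nearest[OF assms]] show ?thesis
    by (simp add: nearest_restrict)
qed

text \<open>For \<open>f\<close> with values in \<open>[0, 1]\<close>, replacing \<open>f y\<close> by its value at the nearest net point costs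
  at most \<open>2 * r\<close> in the integral off the missing mass, and \<open>r\<close> in the empirical mean. What
  remains is linear in the values of \<open>f\<close> on the net, hence largest when these are \<open>0\<close> or \<open>1\<close>.\<close>

lemma lipschitz_deviation_le:
  fixes M :: "'a::{metric_space, second_countable_topology} measure" and f :: "'a \<Rightarrow> real"
  assumes "prob_space M" and M: "sets M = sets borel"
    and lip: "\<And>x y. \<bar>f x - f y\<bar> \<le> dist x y" and f01: "\<And>x. 0 \<le> f x" "\<And>x. f x \<le> 1"
    and "r \<ge> 0" and net: "is_net n X r I" and m: "card I = m" "1 \<le> m" "m < n"
    and dev: "\<And>A. A \<in> test_sets I r \<Longrightarrow>
      measure M (A X) \<le> t + (\<Sum>i\<in>{1..n} - I. indicator (A X) (X i)) / (real n - real m)"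
  shows "integral\<^sup>L M f - (\<Sum>i=1..n. f (X i)) / real n
    \<le> missing_mass M n X r + 3 * r + t + real m / real n"
proof -
  interpret prob_space M by fact
  have space: "space M = UNIV"
    using sets_eq_imp_space_eq[OF M] by simp
  have I: "I \<subseteq> {1..n}" "finite I" "I \<noteq> {}"
    using net m finite_subset[of I "{1..n}"] by (auto simp: is_net_def)
  let ?J = "{1..n} - I" and ?N = "real n - real m"
  have N: "?N > 0" "real (card ?J) = ?N"
    using I m by (simp_all add: card_Diff_subset of_nat_diff)
  have cover: "\<forall>i\<in>{1..n}. \<exists>k\<in>I. dist (X i) (X k) \<le> r"
    using net unfolding is_net_def by (elim conjE)
  define p where "p = nearest I X"
  have p_meas [measurable]: "p \<in> measurable M (count_space UNIV)"
    unfolding p_def by (rule measurable_nearest_section[OF M])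
  have pI: "p y \<in> I" and ple: "k \<in> I \<Longrightarrow> dist y (X (p y)) \<le> dist y (X k)" for y k
    unfolding p_def using nearest_in[OF I(2,3)] nearest_le[OF I(2,3)] by auto
  define F where "F = {y. \<forall>i\<in>{1..n}. dist y (X i) > r}"
  have [measurable]: "F \<in> sets M"
    unfolding M F_def by measurable
  have [measurable]: "f \<in> borel_measurable M"
    using borel_measurable_continuous_onI[OF continuous_on_1_lipschitz[OF lip]]
    by (simp add: measurable_cong_sets[OF M refl])
  have int_f: "integrable M f"
    using f01 by (intro integrable_const_bound[of _ 1]) auto
  define g where "g j = f (X j)" for j
  note g_int = integral_nearest[OF assms(1) I(2,3), of X g, folded p_def, OF p_meas]
  \<comment> \<open>On \<open>F\<close>, the bound f \<le> 1 is charged to the indicator. Off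
    \<open>F\<close>, some sample point lies within \<open>r\<close> of \<open>y\<close> and some
    net point within \<open>r\<close> of that, whence 2 r.\<close>
  have up: "f y \<le> g (p y) + 2 * r + indicator F y" for y
  proof (cases "y \<in> F")
    case True
    then show ?thesis
      using \<open>r \<ge> 0\<close> f01(1)[of "X (p y)"] f01(2)[of y] by (simp add: g_def)
  next
    case False
    then obtain i where i: "i \<in> {1..n}" "dist y (X i) \<le> r"
      by (auto simp: F_def not_less)
    obtain k where k: "k \<in> I" "dist (X i) (X k) \<le> r"
      using bspec[OF cover i(1)] by blast
    have "dist y (X (p y)) \<le> 2 * r"
      using ple[OF k(1), of y] dist_triangle[of y "X k" "X i"] i k by simp
    then show ?thesis
      using lip[of y "X (p y)"] False by (simp add: g_def)
  qed
  \<comment> \<open>A sample point is itself within \<open>r\<close> of the net, so rounding costs a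
    single \<open>r\<close> here.\<close>
  have low: "g (p (X i)) - r \<le> f (X i)" if i: "i \<in> {1..n}" for i
  proof -
    obtain k where k: "k \<in> I" "dist (X i) (X k) \<le> r"
      using bspec[OF cover i] by blast
    then show ?thesis
      using lip[of "X i" "X (p (X i))"] ple[OF k(1), of "X i"] by (simp add: g_def)
  qed
  \<comment> \<open>True and empirical probabilities of the cells. The frequencies leave out the net
    points, on which the cells depend.\<close>
  define a where "a j = measure M (p -` {j})" for j
  define b where "b j = (\<Sum>i\<in>?J. indicator (p -` {j}) (X i)) / ?N" for j
  have int_F: "integrable M (indicator F :: 'a \<Rightarrow> real)"
    by (intro integrable_real_indicator) (auto simp: emeasure_eq_measure)
  have "integral\<^sup>L M f \<le> (\<integral>y. g (p y) + 2 * r + indicator F y \<partial>M)"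
    using up by (intro integral_mono int_f Bochner_Integration.integrable_add g_int(2) int_F) auto
  also have "\<dots> = (\<integral>y. g (p y) \<partial>M) + 2 * r + measure M F"
    using g_int(2) int_F by (simp add: prob_space)
  also have "measure M F = missing_mass M n X r"
    by (simp add: missing_mass_def F_def space)
  finally have ub: "integral\<^sup>L M f \<le> (\<Sum>j\<in>I. g j * a j) + 2 * r + missing_mass M n X r"
    using g_int(1) by (simp add: a_def space)
  have gb: "(\<Sum>j\<in>I. g j * b j) = (\<Sum>i\<in>?J. g (p (X i))) / ?N"
  proof -
    have "(\<Sum>j\<in>I. g j * b j) = (\<Sum>j\<in>I. \<Sum>i\<in>?J. g j * indicator (p -` {j}) (X i)) / ?N"
      by (simp only: b_def times_divide_eq_right sum_distrib_left sum_divide_distrib)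
    also have "(\<Sum>j\<in>I. \<Sum>i\<in>?J. g j * indicator (p -` {j}) (X i))
        = (\<Sum>i\<in>?J. \<Sum>j\<in>I. g j * indicator (p -` {j}) (X i))"
      by (rule sum.swap)
    also have "\<dots> = (\<Sum>i\<in>?J. g (p (X i)))"
      using pI I by (intro sum.cong) (simp_all add: indicator_def if_distrib cong: if_cong)
    finally show ?thesis .
  qed
  define s where "s = (\<Sum>j\<in>I. g j * b j)"
  have s_sum: "(\<Sum>i\<in>?J. g (p (X i))) = s * ?N"
    using gb N by (simp add: s_def)
  have "(\<Sum>i\<in>?J. g (p (X i))) \<le> (\<Sum>i\<in>?J. 1)"
    using f01 by (intro sum_mono) (simp add: g_def)
  then have s1: "s \<le> 1"
    using s_sum N by simp
  \<comment> \<open>The net points return at no cost: their terms are nonnegative.\<close>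
  have s_shift: "s * ?N - ?N * r \<le> (\<Sum>i=1..n. f (X i))"
  proof -
    have "s * ?N - ?N * r = (\<Sum>i\<in>?J. g (p (X i)) - r)"
      using s_sum N by (simp add: sum_subtractf)
    also have "\<dots> \<le> (\<Sum>i\<in>?J. f (X i))"
      using low by (intro sum_mono) auto
    also have "\<dots> \<le> (\<Sum>i=1..n. f (X i))"
      using f01 by (intro sum_mono2) auto
    finally show ?thesis .
  qed
  \<comment> \<open>Passing from the normalisation n - m to n loses at most m / n, because s - r
    \<le> 1.\<close>
  have lb: "s - r - real m / real n \<le> (\<Sum>i=1..n. f (X i)) / real n"
  proof -
    have "real m * s \<le> real m * 1" "0 \<le> real m * r"
      using s1 \<open>r \<ge> 0\<close> by (intro mult_left_mono mult_nonneg_nonneg; simp)+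
    then have "(s - r) * real n - real m \<le> s * ?N - ?N * r"
      by (simp add: algebra_simps)
    also note s_shift
    finally have "((s - r) * real n - real m) / real n \<le> (\<Sum>i=1..n. f (X i)) / real n"
      by (rule divide_right_mono) simp
    then show ?thesis
      using m by (simp add: diff_divide_distrib)
  qed
  \<comment> \<open>The maximising weights are 1 where the true probability exceeds the frequency
    and 0 elsewhere. The chosen cells then merge into a single test set.\<close>
  define S where "S = {j \<in> I. a j > b j}"
  have "(\<Sum>j\<in>I. g j * a j) - s = (\<Sum>j\<in>I. g j * (a j - b j))"
    by (simp add: s_def sum_subtractf right_diff_distrib)
  also have "\<dots> \<le> (\<Sum>j\<in>I. if j \<in> S then a j - b j else 0)"
  proof (rule sum_mono)
    fix j assume "j \<in> I"
    then show "g j * (a j - b j) \<le> (if j \<in> S then a j - b j else 0)"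
      using f01[of "X j"]
      by (auto simp: S_def g_def mult_left_le_one_le mult_nonneg_nonpos not_less)
  qed
  also have "\<dots> = (\<Sum>j\<in>S. a j) - (\<Sum>j\<in>S. b j)"
    using I by (simp add: S_def sum_subtractf flip: sum.inter_filter)
  also have "(\<Sum>j\<in>S. a j) = measure M (p -` S)"
  proof -
    have "p -` {j} \<in> sets M" for j
      using measurable_sets[OF p_meas, of "{j}"] by (simp add: space)
    then have "measure M (\<Union>j\<in>S. p -` {j}) = (\<Sum>j\<in>S. a j)"
      unfolding a_def using I
      by (intro finite_measure_finite_Union) (auto simp: S_def disjoint_family_on_def)
    moreover have "(\<Union>j\<in>S. p -` {j}) = p -` S"
      by auto
    ultimately show ?thesis
      by simp
  qed
  also have "(\<Sum>j\<in>S. b j) = (\<Sum>i\<in>?J. indicator (p -` S) (X i)) / ?N"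
  proof -
    have "(\<Sum>j\<in>S. b j) = (\<Sum>i\<in>?J. \<Sum>j\<in>S. indicator (p -` {j}) (X i)) / ?N"
      unfolding b_def by (subst sum.swap) (simp only: sum_divide_distrib)
    also have "\<dots> = (\<Sum>i\<in>?J. indicator (p -` S) (X i)) / ?N"
      using I by (intro arg_cong2[where f = "(/)"] sum.cong refl)
        (simp_all add: S_def indicator_def if_distrib cong: if_cong)
    finally show ?thesis .
  qed
  also have "measure M (p -` S) - \<dots> \<le> t"
  proof -
    have "(\<lambda>X. {y. nearest I X y \<in> S}) \<in> test_sets I r"
      unfolding test_sets_def by (intro insertI2 imageI) (auto simp: S_def)
    from dev[OF this] show ?thesis
      by (simp add: p_def vimage_def)
  qed
  finally have "(\<Sum>j\<in>I. g j * a j) - s \<le> t" .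
  then show ?thesis
    using ub lb by linarith
qed

text \<open>The missing mass depends on the whole sample, including the points that would test it.
  Enlarging the region to all points farther than \<open>r\<close> from the net alone yields a test
  set, and the covering property of the net keeps it free of sample points.\<close>

lemma missing_mass_le:
  fixes M :: "'a::{metric_space, second_countable_topology} measure"
  assumes "prob_space M" and M: "sets M = sets borel" and net: "is_net n X r I"
    and dev: "\<And>A. A \<in> test_sets I r \<Longrightarrow>
      measure M (A X) \<le> t + (\<Sum>i\<in>{1..n} - I. indicator (A X) (X i)) / (real n - real m)"
  shows "missing_mass M n X r \<le> t"
proof -
  interpret prob_space M by fact
  let ?A = "{y. \<forall>j\<in>I. dist y (X j) > r}"
  have I: "I \<subseteq> {1..n}"
    using net by (simp add: is_net_def)
  have "?A \<in> sets M"
    unfolding M by measurable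
  then have "missing_mass M n X r \<le> measure M ?A"
    unfolding missing_mass_def using I by (intro finite_measure_mono) auto
  also have "\<dots> \<le> t + (\<Sum>i\<in>{1..n} - I. indicator ?A (X i)) / (real n - real m)"
    by (rule dev[of "\<lambda>X. {y. \<forall>j\<in>I. dist y (X j) > r}"]) (simp add: test_sets_def)
  also have "(\<Sum>i\<in>{1..n} - I. indicator ?A (X i) :: real) = 0"
    using net by (intro sum.neutral) (force simp: is_net_def indicator_def not_less)
  finally show ?thesis
    by simp
qed

section \<open>Normalised test functions and measurability of the events\<close>

lemma wasserstein1_empirical:
  fixes M :: "'a::metric_space measure"
  assumes M: "sets M = sets borel" and "n \<ge> 1"
  shows "wasserstein1 M (empirical_measure n X)
    = (SUP f\<in>{f. lip_seminorm f = 1}. integral\<^sup>L M f - (\<Sum>i=1..n. f (X i)) / real n)"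
  unfolding wasserstein1_def
proof (rule SUP_cong)
  fix f :: "'a \<Rightarrow> real" assume "f \<in> {f. lip_seminorm f = 1}"
  then have "f \<in> borel_measurable borel"
    by (intro borel_measurable_continuous_onI continuous_on_1_lipschitz lip_seminorm_le_1D) auto
  then show "integral\<^sup>L M f - integral\<^sup>L (empirical_measure n X) f
      = integral\<^sup>L M f - (\<Sum>i=1..n. f (X i)) / real n"
    using assms by (simp add: integral_empirical_measure)
qed simp

text \<open>Both measures have mass 1, so a constant added to \<open>f\<close> cancels in the
  difference. Since distances are at most 1, \<open>f\<close> oscillates by at most 1, and
  subtracting its infimum lands in [0, 1].\<close>

lemma lipschitz_deviation_shift:
  fixes M :: "'a::metric_space measure" and f :: "'a \<Rightarrow> real"
  assumes "prob_space M" and M: "sets M = sets borel" and n: "n \<ge> 1"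
    and diam: "\<And>x y::'a. dist x y \<le> 1" and lip: "\<And>x y. \<bar>f x - f y\<bar> \<le> dist x y"
  obtains g where "\<And>x y. \<bar>g x - g y\<bar> \<le> dist x y" "\<And>x. 0 \<le> g x" "\<And>x. g x \<le> 1"
    and "integral\<^sup>L M f - (\<Sum>i=1..n. f (X i)) / real n
      = integral\<^sup>L M g - (\<Sum>i=1..n. g (X i)) / real n"
proof -
  interpret prob_space M by fact
  have f1: "f x - 1 \<le> f y" for x y
    using lip[of x y] diam[of x y] by linarith
  define c where "c = (INF x. f x)"
  define g where "g x = f x - c" for x
  have "bdd_below (range f)"
    using f1[of undefined] by (intro bdd_belowI[of _ "f undefined - 1"]) auto
  then have g0: "0 \<le> g x" for x
    by (simp add: g_def c_def cINF_lower)
  have g1: "g x \<le> 1" for x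
    using cINF_greatest[of UNIV "f x - 1" f] f1 by (simp add: g_def c_def)
  have glip: "\<bar>g x - g y\<bar> \<le> dist x y" for x y
    using lip by (simp add: g_def)
  have [measurable]: "g \<in> borel_measurable M"
    using borel_measurable_continuous_onI[OF continuous_on_1_lipschitz[OF glip]]
    by (simp add: measurable_cong_sets[OF M refl])
  have "integrable M g"
    using g0 g1 by (intro integrable_const_bound[of _ 1]) auto
  then have "integral\<^sup>L M (\<lambda>x. g x + c) = integral\<^sup>L M g + c"
    by (simp add: prob_space)
  moreover have "(\<Sum>i=1..n. f (X i)) / real n = (\<Sum>i=1..n. g (X i)) / real n + c"
    using n by (simp add: g_def sum_subtractf field_simps)
  ultimately show thesis
    by (intro that[of g] glip g0 g1) (simp add: g_def)
qed

text \<open>A supremum of uncountably many functions, but of continuous ones: its strict superlevel sets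
  are open, and on sequences in a second countable space the Borel sets are the product sets.\<close>

lemma measurable_wasserstein1_empirical:
  fixes M :: "'a::{metric_space, second_countable_topology} measure"
  assumes "prob_space M" and M: "sets M = sets borel" and n: "n \<ge> 1"
    and diam: "\<And>x y::'a. dist x y \<le> 1" and neq: "x0 \<noteq> (y0::'a)"
  shows "(\<lambda>X. wasserstein1 M (empirical_measure n X)) \<in> borel_measurable (Pi\<^sub>M {1..n} (\<lambda>_. M))"
proof -
  interpret prob_space M by fact
  let ?F = "{f::'a \<Rightarrow> real. lip_seminorm f = 1}"
  let ?\<phi> = "\<lambda>f (X::nat \<Rightarrow> 'a). integral\<^sup>L M f - (\<Sum>i=1..n. f (X i)) / real n"
  have ne: "?F \<noteq> {}"
    using lip_seminorm_dist[OF neq] by blast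
  \<comment> \<open>Boundedness lets \<open>less_cSUP_iff\<close> turn a superlevel set of the
    supremum into a union of superlevel sets.\<close>
  have bdd: "bdd_above ((\<lambda>f. ?\<phi> f X) ` ?F)" for X
  proof (rule bdd_aboveI2)
    fix f assume "f \<in> ?F"
    then have "\<bar>f x - f y\<bar> \<le> dist x y" for x y
      by (intro lip_seminorm_le_1D) simp
    then obtain g where g: "\<And>x y. \<bar>g x - g y\<bar> \<le> dist x y" "\<And>x. 0 \<le> g x" "\<And>x. g x \<le> 1"
      "?\<phi> f X = ?\<phi> g X"
      using lipschitz_deviation_shift[OF assms(1) M n diam, of f X] by blast
    have [measurable]: "g \<in> borel_measurable M"
      using borel_measurable_continuous_onI[OF continuous_on_1_lipschitz[OF g(1)]]
      by (simp add: measurable_cong_sets[OF M refl])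
    have "integrable M g"
      using g by (intro integrable_const_bound[of _ 1]) auto
    then have "integral\<^sup>L M g \<le> 1"
      using g by (intro integral_le_const) auto
    moreover have "(\<Sum>i=1..n. g (X i)) / real n \<ge> 0"
      using g by (intro divide_nonneg_nonneg sum_nonneg) auto
    ultimately show "?\<phi> f X \<le> 1"
      unfolding g(4) by linarith
  qed
  have op: "open {X. a < ?\<phi> f X}" if "f \<in> ?F" for f a
  proof -
    have f: "continuous_on UNIV f"
      using that by (intro continuous_on_1_lipschitz lip_seminorm_le_1D) simp
    have "continuous_on UNIV (\<lambda>X. f (X i))" for i :: nat
      by (rule continuous_on_compose2[OF f]) (auto intro: continuous_on_product_coordinates)
    then have "continuous_on UNIV (?\<phi> f)"
      using n by (intro continuous_intros) auto
    then show ?thesis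
      by (intro open_Collect_less continuous_on_const)
  qed
  have "(\<lambda>X. SUP f\<in>?F. ?\<phi> f X) \<in> borel_measurable (borel :: (nat \<Rightarrow> 'a) measure)"
    unfolding borel_measurable_iff_greater
  proof
    fix a
    have "{X \<in> space borel. a < (SUP f\<in>?F. ?\<phi> f X)} = (\<Union>f\<in>?F. {X. a < ?\<phi> f X})"
      using less_cSUP_iff[OF ne bdd] by auto
    also have "open \<dots>"
      using op by (intro open_UN) auto
    finally show "{X \<in> space borel. a < (SUP f\<in>?F. ?\<phi> f X)}
        \<in> sets (borel :: (nat \<Rightarrow> 'a) measure)"
      by (rule borel_open)
  qed
  then have W: "(\<lambda>X. wasserstein1 M (empirical_measure n X))
      \<in> borel_measurable (borel :: (nat \<Rightarrow> 'a) measure)"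
    using n by (simp add: wasserstein1_empirical[OF M])
  \<comment> \<open>Coordinates in {1..n} are projections; at every other index a point of the
    product space has the constant value \<open>undefined\<close>.\<close>
  have "(\<lambda>X. X) \<in> measurable (Pi\<^sub>M {1..n} (\<lambda>_. M)) (borel :: (nat \<Rightarrow> 'a) measure)"
  proof (rule measurable_coordinatewise_then_product)
    fix i
    show "(\<lambda>X. X i) \<in> measurable (Pi\<^sub>M {1..n} (\<lambda>_. M)) (borel :: 'a measure)"
    proof (cases "i \<in> {1..n}")
      case True
      then have "(\<lambda>X. X i) \<in> measurable (Pi\<^sub>M {1..n} (\<lambda>_. M)) M"
        by simp
      then show ?thesis
        by (simp add: measurable_cong_sets[OF refl M])
    next
      case False
      have "(\<lambda>X. undefined) \<in> measurable (Pi\<^sub>M {1..n} (\<lambda>_. M)) (borel :: 'a measure)"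
        by simp
      then show ?thesis
        by (rule measurable_cong[THEN iffD1, rotated])
          (use False in \<open>auto simp: space_PiM PiE_def extensional_def\<close>)
    qed
  qed
  from measurable_compose[OF this W] show ?thesis .
qed

text \<open>The missing mass is the measure of a section of a product-measurable set, so this is the
  measurability half of Tonelli's theorem.\<close>

lemma measurable_missing_mass:
  fixes M :: "'a::{metric_space, second_countable_topology} measure"
  assumes "prob_space M" and [measurable_cong]: "sets M = sets borel"
  shows "(\<lambda>X. missing_mass M n X r) \<in> borel_measurable (Pi\<^sub>M {1..n} (\<lambda>_. M))"
proof -
  interpret prob_space M by fact
  let ?P = "Pi\<^sub>M {1..n} (\<lambda>_. M)"
  let ?Q = "{p \<in> space (?P \<Otimes>\<^sub>M M). \<forall>i\<in>{1..n}. dist (snd p) (fst p i) > r}"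
  have "Measurable.pred (?P \<Otimes>\<^sub>M M) (\<lambda>p. \<forall>i\<in>{1..n}. dist (snd p) (fst p i) > r)"
  proof (intro pred_intros_countable_bounded(3))
    fix i assume "i \<in> {1..n}"
    then have [measurable]: "(\<lambda>p. fst p i) \<in> measurable (?P \<Otimes>\<^sub>M M) borel"
      by measurable
    show "Measurable.pred (?P \<Otimes>\<^sub>M M) (\<lambda>p. dist (snd p) (fst p i) > r)"
      by measurable
  qed
  then have Q: "?Q \<in> sets (?P \<Otimes>\<^sub>M M)"
    by (simp add: pred_def)
  have "(\<lambda>X. measure M (Pair X -` ?Q)) \<in> borel_measurable ?P"
    unfolding measure_def using measurable_emeasure_Pair[OF Q] by measurable
  moreover have "measure M (Pair X -` ?Q) = missing_mass M n X r" if "X \<in> space ?P" for X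
    using that unfolding missing_mass_def
    by (intro arg_cong[where f = "measure M"]) (auto simp: space_pair_measure)
  ultimately show ?thesis
    by (rule measurable_cong[THEN iffD1, rotated])
qed

lemma measurable_ex_net:
  fixes M :: "'a::{metric_space, second_countable_topology} measure"
  assumes [measurable_cong]: "sets M = sets borel"
  shows "Measurable.pred (Pi\<^sub>M {1..n} (\<lambda>_. M)) (\<lambda>X. \<exists>I. is_net n X r I \<and> card I = m)"
proof -
  let ?P = "Pi\<^sub>M {1..n} (\<lambda>_. M)"
  have coord: "(\<lambda>X. X i) \<in> measurable ?P borel" if "i \<in> {1..n}" for i
    using that by measurable
  have d [measurable]: "(\<lambda>X. dist (X i) (X j)) \<in> borel_measurable ?P"
    if "i \<in> {1..n}" "j \<in> {1..n}" for i j
    using coord[OF that(1)] coord[OF that(2)] by measurable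
  have "Measurable.pred ?P (\<lambda>X. is_net n X r I)" if I: "I \<subseteq> {1..n}" for I
  proof -
    have "Measurable.pred ?P (\<lambda>X. \<forall>i\<in>I. \<forall>j\<in>I. i \<noteq> j \<longrightarrow> dist (X i) (X j) > r)"
      using I by (intro pred_intros_countable_bounded(3) pred_intros_imp' borel_measurable_pred_less d
          measurable_const) auto
    moreover have "Measurable.pred ?P (\<lambda>X. \<forall>k\<in>{1..n}. \<exists>i\<in>I. dist (X k) (X i) \<le> r)"
    proof (intro pred_intros_countable_bounded(3,4))
      fix k i assume "k \<in> {1..n}" "i \<in> I"
      with I have [measurable]: "(\<lambda>X. dist (X k) (X i)) \<in> borel_measurable ?P"
        by (intro d) auto
      show "Measurable.pred ?P (\<lambda>X. dist (X k) (X i) \<le> r)"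
        by measurable
    qed
    ultimately show ?thesis
      unfolding is_net_def by (intro pred_intros_conj1' pred_intros_logic(3))
  qed
  \<comment> \<open>Only subsets of {1..n} can be nets, so the quantifier over all index sets
    becomes a finite one.\<close>
  then have "Measurable.pred ?P (\<lambda>X. \<exists>I\<in>{I \<in> Pow {1..n}. card I = m}. is_net n X r I)"
    by (intro pred_intros_finite(4)) simp_all
  also have "(\<lambda>X. \<exists>I\<in>{I \<in> Pow {1..n}. card I = m}. is_net n X r I)
      = (\<lambda>X. \<exists>I. is_net n X r I \<and> card I = m)"
    unfolding is_net_def by blast
  finally show ?thesis .
qed

section \<open>Numerical constants and the conclusion\<close>

text \<open>Put L = ln (n / \<delta>) \<ge> 0. As ln 4 \<le> 2, half of ln (4 n / \<delta>) is at
  most 1 + L / 2 \<le> (1 + sqrt L)^2. The cost m / n of the net points is at most its own square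
  root, hence at most \<open>q\<close>.\<close>

lemma deviation_width_le:
  fixes n m :: nat and \<delta> :: real
  assumes m: "1 \<le> m" "2 * real m \<le> real n" and \<delta>: "0 < \<delta>" "\<delta> \<le> 1"
  defines "t \<equiv> sqrt (real m * ln (4 * real n / \<delta>) / (2 * (real n - real m)))"
    and "q \<equiv> sqrt (real m / (real n - real m))"
  shows "t \<le> q * (1 + sqrt (ln (real n / \<delta>)))" and "real m / real n \<le> q"
proof -
  have N: "real n - real m > 0" "real n > 0"
    using m by simp_all
  define L where "L = ln (real n / \<delta>)"
  have "1 \<le> real n / \<delta>"
    using m \<delta> by (simp add: divide_simps)
  then have L: "L \<ge> 0"
    by (simp add: L_def)
  have "ln 4 = 2 * ln (2::real)"
    using ln_realpow[of 2 2] by simp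
  then have "ln (4::real) \<le> 2"
    using ln_le_minus_one[of "2::real"] by simp
  moreover have "ln (4 * real n / \<delta>) = ln 4 + L"
    using N \<delta> ln_mult[of 4 "real n / \<delta>"] by (simp add: L_def)
  moreover have "(1 + sqrt L)\<^sup>2 = 1 + 2 * sqrt L + L"
    using L by (simp add: power2_sum)
  ultimately have "ln (4 * real n / \<delta>) / 2 \<le> (1 + sqrt L)\<^sup>2"
    using L real_sqrt_ge_zero[OF L] by linarith
  then have "sqrt (ln (4 * real n / \<delta>) / 2) \<le> 1 + sqrt L"
    using L by (intro real_le_lsqrt) simp_all
  moreover have "t = q * sqrt (ln (4 * real n / \<delta>) / 2)"
    unfolding t_def q_def by (simp flip: real_sqrt_mult add: mult.commute)
  moreover have "q \<ge> 0"
    using N by (simp add: q_def)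
  ultimately show "t \<le> q * (1 + sqrt (ln (real n / \<delta>)))"
    unfolding L_def by (simp add: mult_left_mono)
  have "(real m / real n)\<^sup>2 \<le> real m / real n * 1"
    unfolding power2_eq_square using m N by (intro mult_left_mono) simp_all
  also have "\<dots> \<le> real m / (real n - real m)"
    using N by (simp add: frac_le)
  finally show "real m / real n \<le> q"
    unfolding q_def by (rule real_le_rsqrt)
qed

theorem theorem3p1:
  fixes \<mu> :: "'a::polish_space measure" and r \<delta> :: real and n m :: nat
  assumes "bounded (UNIV :: 'a set)" and "diameter (UNIV :: 'a set) = 1"
    and "prob_space \<mu>" and "sets \<mu> = sets borel"
    and "r > 0"
    and "1 \<le> m" and "real m \<le> (real n - 3) / 2"
    and "\<delta> > 0"
  shows "\<P>(X in Pi\<^sub>M {1..n} (\<lambda>_. \<mu>).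
           (\<exists>I. is_net n X r I \<and> card I = m) \<longrightarrow>
             wasserstein1 \<mu> (empirical_measure n X)
               \<le> missing_mass \<mu> n X r + 3 * r
                 + 2 * sqrt (real m / (real n - real m)) * (1 + sqrt (ln (real n / \<delta>))))
         \<ge> 1 - \<delta>
    \<and> \<P>(X in Pi\<^sub>M {1..n} (\<lambda>_. \<mu>).
           (\<exists>I. is_net n X r I \<and> card I = m) \<longrightarrow>
             wasserstein1 \<mu> (empirical_measure n X)
               \<le> 3 * r
                 + 3 * sqrt (real m / (real n - real m)) * (1 + sqrt (ln (2 * real n / \<delta>))))
         \<ge> 1 - \<delta>"
proof (cases "\<delta> \<le> 1")
  \<comment> \<open>For \<delta> > 1 the required lower bound is negative.\<close>
  case False
  then show ?thesis
    by (auto intro: order_trans[OF _ measure_nonneg])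
next
  case True
  interpret \<mu>: prob_space \<mu> by fact
  let ?P = "Pi\<^sub>M {1..n} (\<lambda>_. \<mu>)"
  interpret P: prob_space ?P
    by (intro prob_space_PiM assms)
  note M = \<open>sets \<mu> = sets borel\<close>
  have n: "n \<ge> 1" "m < n" "2 * real m \<le> real n"
    using assms by auto
  have diam: "dist x y \<le> 1" for x y :: 'a
    using diameter_bounded_bound[OF assms(1), of x y] assms(2) by simp
  \<comment> \<open>On a one-point space no function has seminorm 1, and the supremum would be over
    the empty set; diameter 1 rules this out.\<close>
  have "\<exists>x y :: 'a. x \<noteq> y"
  proof (rule ccontr)
    assume "\<nexists>x y :: 'a. x \<noteq> y"
    then have "UNIV = {undefined :: 'a}"
      by blast
    then show False
      using assms(2) by (metis diameter_singleton zero_neq_one)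
  qed
  then obtain x0 y0 :: 'a where neq: "x0 \<noteq> y0"
    by blast
  define t where "t = sqrt (real m * ln (4 * real n / \<delta>) / (2 * (real n - real m)))"
  define q where "q = sqrt (real m / (real n - real m))"
  have q0: "q \<ge> 0"
    using n by (simp add: q_def)
  have t: "t \<le> q * (1 + sqrt (ln (real n / \<delta>)))" and mn: "real m / real n \<le> q"
    unfolding t_def q_def using deviation_width_le[of m n \<delta>] assms n True by auto
  have "ln (real n / \<delta>) \<le> ln (2 * real n / \<delta>)" "0 \<le> ln (real n / \<delta>)"
    using n True \<open>\<delta> > 0\<close> by (simp_all add: divide_simps)
  then have sq: "sqrt (ln (real n / \<delta>)) \<le> sqrt (ln (2 * real n / \<delta>))" "0 \<le> sqrt (ln (real n / \<delta>))"
    by simp_all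
  have t': "t \<le> q * (1 + sqrt (ln (2 * real n / \<delta>)))"
    using t mult_left_mono[OF sq(1) q0] by (simp add: algebra_simps)
  have qa: "0 \<le> q * sqrt (ln (real n / \<delta>))" "0 \<le> q * sqrt (ln (2 * real n / \<delta>))"
    using q0 sq by simp_all
  \<comment> \<open>This one event serves both assertions.\<close>
  obtain G where G: "G \<in> sets ?P" "measure ?P G \<ge> 1 - \<delta>"
    and dev: "\<And>X I A. X \<in> G \<Longrightarrow> I \<subseteq> {1..n} \<Longrightarrow> card I = m \<Longrightarrow> A \<in> test_sets I r \<Longrightarrow>
      measure \<mu> (A X) \<le> t + (\<Sum>i\<in>{1..n} - I. indicator (A X) (X i)) / (real n - real m)"
    unfolding t_def
    using uniform_deviation_test_sets[OF assms(3) M assms(6) n(2) assms(8) True] by blast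
  have W: "wasserstein1 \<mu> (empirical_measure n X) \<le> missing_mass \<mu> n X r + 3 * r + t + q"
    and mass: "missing_mass \<mu> n X r \<le> t"
    if X: "X \<in> G" and I: "is_net n X r I" "card I = m" for X I
  proof -
    have sub: "I \<subseteq> {1..n}"
      using I by (simp add: is_net_def)
    note devI = dev[OF X sub I(2)]
    show "missing_mass \<mu> n X r \<le> t"
      by (rule missing_mass_le[OF assms(3) M I(1)]) (rule devI)
    show "wasserstein1 \<mu> (empirical_measure n X) \<le> missing_mass \<mu> n X r + 3 * r + t + q"
      unfolding wasserstein1_empirical[OF M n(1)]
    proof (rule cSUP_least)
      show "{f :: 'a \<Rightarrow> real. lip_seminorm f = 1} \<noteq> {}"
        using lip_seminorm_dist[OF neq] by blast
      fix f :: "'a \<Rightarrow> real" assume "f \<in> {f. lip_seminorm f = 1}"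
      then have "\<bar>f x - f y\<bar> \<le> dist x y" for x y
        by (intro lip_seminorm_le_1D) simp
      then obtain g where g: "\<And>x y. \<bar>g x - g y\<bar> \<le> dist x y" "\<And>x. 0 \<le> g x" "\<And>x. g x \<le> 1"
        and eq: "integral\<^sup>L \<mu> f - (\<Sum>i=1..n. f (X i)) / real n
          = integral\<^sup>L \<mu> g - (\<Sum>i=1..n. g (X i)) / real n"
        using lipschitz_deviation_shift[OF assms(3) M n(1) diam, of f X] by blast
      have "integral\<^sup>L \<mu> g - (\<Sum>i=1..n. g (X i)) / real n
          \<le> missing_mass \<mu> n X r + 3 * r + t + real m / real n"
        using \<open>r > 0\<close>
        by (intro lipschitz_deviation_le[OF assms(3) M g _ I(1,2) assms(6) n(2)] devI) simp
      then show "integral\<^sup>L \<mu> f - (\<Sum>i=1..n. f (X i)) / real n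
          \<le> missing_mass \<mu> n X r + 3 * r + t + q"
        using mn eq by linarith
    qed
  qed
  \<comment> \<open>Inclusion of \<open>G\<close> passes its probability on to the target event only
    once the latter is known to be measurable; \<open>h\<close> stands for either right-hand
    side.\<close>
  have E: "{X \<in> space ?P. (\<exists>I. is_net n X r I \<and> card I = m) \<longrightarrow>
      wasserstein1 \<mu> (empirical_measure n X) \<le> h X} \<in> sets ?P"
    if h: "h \<in> borel_measurable ?P" for h
  proof -
    have "Measurable.pred ?P (\<lambda>X. wasserstein1 \<mu> (empirical_measure n X) \<le> h X)"
      unfolding pred_def
      by (intro borel_measurable_le measurable_wasserstein1_empirical[OF assms(3) M n(1) diam neq] h)
    with measurable_ex_net[OF M] show ?thesis
      unfolding pred_def[symmetric] by (rule pred_intros_logic(4))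
  qed
  have space: "G \<subseteq> space ?P"
    using sets.sets_into_space[OF G(1)] .
  show ?thesis
    unfolding q_def[symmetric]
  proof
    let ?E = "{X \<in> space ?P. (\<exists>I. is_net n X r I \<and> card I = m) \<longrightarrow>
        wasserstein1 \<mu> (empirical_measure n X)
          \<le> missing_mass \<mu> n X r + 3 * r + 2 * q * (1 + sqrt (ln (real n / \<delta>)))}"
    have "?E \<in> sets ?P"
      by (intro E borel_measurable_add measurable_missing_mass[OF assms(3) M] borel_measurable_const)
    moreover have "G \<subseteq> ?E"
    proof (safe intro!: subsetD[OF space])
      fix X I assume "X \<in> G" "is_net n X r I" "m = card I"
      \<comment> \<open>The deviation \<open>t\<close> and the net cost \<open>q\<close> are each at
        most q (1 + sqrt (ln (n / \<delta>))), which gives the factor 2.\<close>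
      then show "wasserstein1 \<mu> (empirical_measure n X)
          \<le> missing_mass \<mu> n X r + 3 * r + 2 * q * (1 + sqrt (ln (real n / \<delta>)))"
        using W[of X I] t qa by (simp add: algebra_simps)
    qed
    ultimately show "1 - \<delta> \<le> measure ?P ?E"
      using G(2) P.finite_measure_mono[of G ?E] by linarith
  next
    let ?E = "{X \<in> space ?P. (\<exists>I. is_net n X r I \<and> card I = m) \<longrightarrow>
        wasserstein1 \<mu> (empirical_measure n X)
          \<le> 3 * r + 3 * q * (1 + sqrt (ln (2 * real n / \<delta>)))}"
    have "?E \<in> sets ?P"
      by (intro E borel_measurable_add measurable_missing_mass[OF assms(3) M] borel_measurable_const)
    moreover have "G \<subseteq> ?E"
    proof (safe intro!: subsetD[OF space])
      fix X I assume "X \<in> G" "is_net n X r I" "m = card I"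
      \<comment> \<open>Bounding the missing mass contributes a second \<open>t\<close>, which
        raises the factor to 3.\<close>
      then show "wasserstein1 \<mu> (empirical_measure n X)
          \<le> 3 * r + 3 * q * (1 + sqrt (ln (2 * real n / \<delta>)))"
        using W[of X I] mass[of X I] t' qa by (simp add: algebra_simps)
    qed
    ultimately show "1 - \<delta> \<le> measure ?P ?E"
      using G(2) P.finite_measure_mono[of G ?E] by linarith
  qed
qed

end
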